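(* Let $\mathfrak F$ be a stable filtration functor with Lipschitz constant $L(\mathfrak F)$. Then for all compact metric spaces $X,Y$ and integers $n\ge 1$ and $k\ge 0$, $$d_{\mathcal H}^{\mathcal D}\big(D^{\mathfrak F}_{n,k}(X),D^{\mathfrak F}_{n,k}(Y)\big)\le\tfrac12 L(\mathfrak F)\cdot d_{\mathcal H}(K_n(X),K_n(Y)),$$ and thus $$d_{\mathcal H}^{\mathcal D}\big(D^{\mathfrak F}_{n,k}(X),D^{\mathfrak F}_{n,k}(Y)\big)\le L(\mathfrak F)\cdot\widehat d_{\mathcal{GH}}(X,Y).$$
   Context: Filtration functors. A filtered set is a pair $(X,F_X)$ with $X$ a finite set and $F_X:\mathrm{pow}(X)\to\mathbb R$ on nonempty subsets with $F_X(\sigma)\le F_X(\tau)$ if $\sigma\subset\tau$; morphisms $(X,F_X)\to(Y,F_Y)$ are maps $\varphi:X\to Y$ with $F_Y(\varphi(\sigma))\le F_X(\sigma)$. A filtration functor $\mathfrak F$ is a functor from finite metric spaces with 1-Lipschitz maps to filtered sets, of the form $X\mapsto (X,F_X^{\mathfrak F})$. For $r\ge0$ let $L_r=\{\sigma\subset X: F_X^{\mathfrak F}(\sigma)\le r\}$; the persistence module $r\mapsto\widetilde H_k(L_r;\mathbb F)$ (reduced homology over a fixed field) decomposes into finitely many intervals $[b_\alpha,d_\alpha)$, and $\mathrm{dgm}_k^{\mathfrak F}(X)$ is the multiset of points $(b_\alpha,d_\alpha)$. $\mathcal D$ is the set of all finite persistence diagrams with the bottleneck distance $d_{\mathcal B}$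 ($\ell^\infty$ cost for matched points, half the persistence for unmatched points). $\mathfrak F$ is stable if there is $L>0$ with $d_{\mathcal B}(\mathrm{dgm}_k^{\mathfrak F}(X),\mathrm{dgm}_k^{\mathfrak F}(Y))\le L\cdot d_{\mathcal{GH}}(X,Y)$ for all finite metric spaces $X,Y$ and all $k\ge 0$ ($d_{\mathcal{GH}}$ the Gromov-Hausdorff distance, with the factor $\frac12$ convention $d_{\mathcal{GH}}=\frac12\inf_R\mathrm{dis}(R)$); the infimal such $L$ is $L(\mathfrak F)$. Persistence sets: $D^{\mathfrak F}_{n,k}(X):=\{\mathrm{dgm}_k^{\mathfrak F}(X'):X'\subset X,\ |X'|\le n\}\subset\mathcal D$. Curvature sets: $K_n(X)\subset\mathbb R^{n\times n}$ is the set of all matrices $(d_X(x_i,x_j))_{i,j}$ with $(x_1,\dots,x_n)\in X^n$ (repetitions allowed). $d_{\mathcal H}$ is the Hausdorff distance in $\mathbb R^{n\times n}$ with the $\ell^\infty$ metric, $d^{\mathcal D}_{\mathcal H}$ is the Hausdorff distance between subsets of $(\mathcal D,d_{\mathcal B})$, and $\widehat d_{\mathcal{GH}}(X,Y):=\frac12\sup_{n\in\mathbb N}d_{\mathcal H}(K_n(X),K_n(Y))$. *)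

theory Defs
  imports
    "HOL-Analysis.Abstract_Metric_Spaces"
    "HOL-Library.Extended_Nonnegative_Real"
    "HOL-Library.FuncSet"
    "HOL-Library.Multiset"
    "Jordan_Normal_Form.Matrix"
begin

text \<open>
  Spaces are pairs of a carrier \<open>X :: 'a set\<close> and a distance function on it, and the type \<open>'a\<close>
  plays the role of the universe of points: two spaces in the same universe may carry unrelated
  metrics, and spaces living in different types can be moved into a common (infinite) type such as
  a sum type. Metric spaces are nonempty. The Gromov-Hausdorff and Hausdorff distances take values
  in \<open>[0, \<infinity>]\<close>, so that no default value of a real supremum or infimum is involved.
\<close>

definition finite_metric_space :: "'a set \<Rightarrow> ('a \<Rightarrow> 'a \<Rightarrow> real) \<Rightarrow> bool" where
  "finite_metric_space X d \<longleftrightarrow> Metric_space X d \<and> finite X \<and> X \<noteq> {}"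

definition compact_metric_space :: "'a set \<Rightarrow> ('a \<Rightarrow> 'a \<Rightarrow> real) \<Rightarrow> bool" where
  "compact_metric_space X d \<longleftrightarrow>
     Metric_space X d \<and> compact_space (Metric_space.mtopology X d) \<and> X \<noteq> {}"

definition nonexpansive ::
    "'a set \<Rightarrow> ('a \<Rightarrow> 'a \<Rightarrow> real) \<Rightarrow> 'a set \<Rightarrow> ('a \<Rightarrow> 'a \<Rightarrow> real) \<Rightarrow> ('a \<Rightarrow> 'a) \<Rightarrow> bool" where
  "nonexpansive X dX Y dY \<phi> \<longleftrightarrow>
     \<phi> \<in> X \<rightarrow> Y \<and> (\<forall>x\<in>X. \<forall>x'\<in>X. dY (\<phi> x) (\<phi> x') \<le> dX x x')"

definition filtered_set :: "'a set \<Rightarrow> ('a set \<Rightarrow> real) \<Rightarrow> bool" where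
  "filtered_set X f \<longleftrightarrow>
     finite X \<and> (\<forall>\<sigma> \<tau>. \<sigma> \<noteq> {} \<and> \<sigma> \<subseteq> \<tau> \<and> \<tau> \<subseteq> X \<longrightarrow> f \<sigma> \<le> f \<tau>)"

definition filtered_morphism ::
    "'a set \<Rightarrow> ('a set \<Rightarrow> real) \<Rightarrow> 'a set \<Rightarrow> ('a set \<Rightarrow> real) \<Rightarrow> ('a \<Rightarrow> 'a) \<Rightarrow> bool" where
  "filtered_morphism X f Y g \<phi> \<longleftrightarrow>
     \<phi> \<in> X \<rightarrow> Y \<and> (\<forall>\<sigma>. \<sigma> \<noteq> {} \<and> \<sigma> \<subseteq> X \<longrightarrow> g (\<phi> ` \<sigma>) \<le> f \<sigma>)"

text \<open>
  A filtration functor is determined by its object map \<open>(X, d) \<mapsto> (X, F X d)\<close>; on morphisms it is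
  the identity on underlying maps, so that functoriality says that every nonexpansive map is a
  morphism of the associated filtered sets. Applied to identity maps, this also shows that
  \<open>F X d\<close> depends on \<open>d\<close> only through its restriction to \<open>X\<close>.
\<close>

type_synonym 'a filtration = "'a set \<Rightarrow> ('a \<Rightarrow> 'a \<Rightarrow> real) \<Rightarrow> 'a set \<Rightarrow> real"

definition filtration_functor :: "'a filtration \<Rightarrow> bool" where
  "filtration_functor F \<longleftrightarrow>
     (\<forall>X d. finite_metric_space X d \<longrightarrow> filtered_set X (F X d)) \<and>
     (\<forall>X dX Y dY \<phi>. finite_metric_space X dX \<and> finite_metric_space Y dY \<and>
        nonexpansive X dX Y dY \<phi> \<longrightarrow> filtered_morphism X (F X dX) Y (F Y dY) \<phi>)"

definition sublevel_complex :: "'a set \<Rightarrow> ('a set \<Rightarrow> real) \<Rightarrow> real \<Rightarrow> 'a set set" where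
  "sublevel_complex X f r = {\<sigma>. \<sigma> \<noteq> {} \<and> \<sigma> \<subseteq> X \<and> f \<sigma> \<le> r}"

text \<open>
  Oriented chains: a chain is a finitely supported alternating function on the orderings
  \<open>[v\<^sub>0, \<dots>, v\<^sub>k]\<close> of the simplices of \<open>K\<close>; the oriented simplex \<open>[v\<^sub>0, \<dots>, v\<^sub>k]\<close> corresponds to the
  function taking the value of the sign of \<open>\<pi>\<close> at \<open>[v\<^sub>\<pi>\<^sub>0, \<dots>, v\<^sub>\<pi>\<^sub>k]\<close>, and \<open>0\<close> elsewhere.
  The index \<open>m\<close> is the number of vertices, i.e. the dimension plus one. The empty list is allowed
  for every \<open>K\<close>, so \<open>m = 0\<close> gives the augmentation term, a copy of the field.
\<close>

definition chains :: "'a set set \<Rightarrow> nat \<Rightarrow> ('a list \<Rightarrow> 'k::field) set" where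
  "chains K m =
     {c. finite {s. c s \<noteq> 0} \<and>
         (\<forall>s. c s \<noteq> 0 \<longrightarrow> length s = m \<and> distinct s \<and> (s = [] \<or> set s \<in> K)) \<and>
         (\<forall>s i j. i < j \<and> j < length s \<longrightarrow> c (s[i := s ! j, j := s ! i]) = - c s)}"

text \<open>
  In terms of coefficient functions, the usual formula
  \<open>\<partial> [v\<^sub>0, \<dots>, v\<^sub>k] = (\<Sum>i. (-1)\<^sup>i [v\<^sub>0, \<dots>, v\<^sub>i\<^sub>-\<^sub>1, v\<^sub>i\<^sub>+\<^sub>1, \<dots>, v\<^sub>k])\<close> becomes the sum below, since
  moving \<open>v\<^sub>i\<close> to the front of \<open>[v\<^sub>0, \<dots>, v\<^sub>k]\<close> has sign \<open>(-1)\<^sup>i\<close>. For \<open>t = []\<close> it is the augmentation.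
\<close>

definition boundary :: "('a list \<Rightarrow> 'k::field) \<Rightarrow> 'a list \<Rightarrow> 'k" where
  "boundary c t = (\<Sum>v | c (v # t) \<noteq> 0. c (v # t))"

definition cycles :: "'a set set \<Rightarrow> nat \<Rightarrow> ('a list \<Rightarrow> 'k::field) set" where
  "cycles K k = {c \<in> chains K (k + 1). boundary c = (\<lambda>_. 0)}"

definition boundaries :: "'a set set \<Rightarrow> nat \<Rightarrow> ('a list \<Rightarrow> 'k::field) set" where
  "boundaries K k = boundary ` chains K (k + 2)"

definition homology_class ::
    "'a set set \<Rightarrow> nat \<Rightarrow> ('a list \<Rightarrow> 'k::field) \<Rightarrow> ('a list \<Rightarrow> 'k) set" where
  "homology_class K k z = {(\<lambda>s. z s + b s) | b. b \<in> boundaries K k}"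

record ('k, 'v) persistence_module =
  pm_space :: "real \<Rightarrow> 'v set"
  pm_add :: "real \<Rightarrow> 'v \<Rightarrow> 'v \<Rightarrow> 'v"
  pm_scale :: "real \<Rightarrow> 'k \<Rightarrow> 'v \<Rightarrow> 'v"
  pm_map :: "real \<Rightarrow> real \<Rightarrow> 'v \<Rightarrow> 'v"

text \<open>Only the indices \<open>r \<ge> 0\<close> (and structure maps from \<open>r\<close> to \<open>s\<close> with \<open>r \<le> s\<close>) are meaningful.\<close>

definition pm_isomorphic ::
    "('k, 'v) persistence_module \<Rightarrow> ('k, 'w) persistence_module \<Rightarrow> bool" where
  "pm_isomorphic M N \<longleftrightarrow>
     (\<exists>h. (\<forall>r\<ge>0. bij_betw (h r) (pm_space M r) (pm_space N r) \<and>
            (\<forall>x\<in>pm_space M r. \<forall>y\<in>pm_space M r. h r (pm_add M r x y) = pm_add N r (h r x) (h r y)) \<and>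
            (\<forall>a. \<forall>x\<in>pm_space M r. h r (pm_scale M r a x) = pm_scale N r a (h r x))) \<and>
          (\<forall>r s. 0 \<le> r \<and> r \<le> s \<longrightarrow>
            (\<forall>x\<in>pm_space M r. h s (pm_map M r s x) = pm_map N r s (h r x))))"

text \<open>
  The persistence module \<open>r \<mapsto> H\<^sub>k(L r)\<close> (reduced, coefficients in \<open>'k\<close>) of an increasing family
  \<open>L\<close> of complexes. Elements are cosets modulo boundaries; boundaries are added in the scalar
  multiplication in order to get the full coset also for the scalar \<open>0\<close>, and in the structure maps
  in order to pass from a coset at \<open>r\<close> to the one at \<open>s\<close> containing it.
\<close>

definition homology_pm ::
    "(real \<Rightarrow> 'a set set) \<Rightarrow> nat \<Rightarrow> ('k::field, ('a list \<Rightarrow> 'k) set) persistence_module" where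
  "homology_pm L k =
     \<lparr> pm_space = (\<lambda>r. homology_class (L r) k ` cycles (L r) k),
       pm_add = (\<lambda>r A B. {(\<lambda>s. a s + b s) | a b. a \<in> A \<and> b \<in> B}),
       pm_scale = (\<lambda>r c A. {(\<lambda>s. c * a s + b s) | a b. a \<in> A \<and> b \<in> boundaries (L r) k}),
       pm_map = (\<lambda>r r' A. {(\<lambda>s. a s + b s) | a b. a \<in> A \<and> b \<in> boundaries (L r') k}) \<rparr>"

definition interval_pm :: "real \<Rightarrow> real \<Rightarrow> ('k::field, 'k) persistence_module" where
  "interval_pm b d =
     \<lparr> pm_space = (\<lambda>r. if b \<le> r \<and> r < d then UNIV else {0}),
       pm_add = (\<lambda>r. (+)),
       pm_scale = (\<lambda>r. (*)),
       pm_map = (\<lambda>r s x. if b \<le> r \<and> s < d then x else 0) \<rparr>"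

definition direct_sum_pm ::
    "('k, 'v) persistence_module list \<Rightarrow> ('k, 'v list) persistence_module" where
  "direct_sum_pm Ms =
     \<lparr> pm_space = (\<lambda>r. {xs. length xs = length Ms \<and> (\<forall>i<length Ms. xs ! i \<in> pm_space (Ms ! i) r)}),
       pm_add = (\<lambda>r xs ys. map (\<lambda>i. pm_add (Ms ! i) r (xs ! i) (ys ! i)) [0..<length Ms]),
       pm_scale = (\<lambda>r c xs. map (\<lambda>i. pm_scale (Ms ! i) r c (xs ! i)) [0..<length Ms]),
       pm_map = (\<lambda>r s xs. map (\<lambda>i. pm_map (Ms ! i) r s (xs ! i)) [0..<length Ms]) \<rparr>"

type_synonym diagram = "(real \<times> real) multiset"

definition has_diagram :: "('k::field, 'v) persistence_module \<Rightarrow> diagram \<Rightarrow> bool" where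
  "has_diagram M D \<longleftrightarrow>
     (\<exists>Is. mset Is = D \<and> (\<forall>(b, d)\<in>set Is. 0 \<le> b \<and> b < d) \<and>
           pm_isomorphic M (direct_sum_pm (map (\<lambda>(b, d). interval_pm b d) Is)))"

text \<open>
  All deaths are finite: for large \<open>r\<close> the sublevel complex is the full simplex on \<open>X\<close>, whose
  reduced homology vanishes. The multiset of intervals of a decomposition is unique.
\<close>

definition dgm ::
    "'k::field itself \<Rightarrow> 'a filtration \<Rightarrow> nat \<Rightarrow> 'a set \<Rightarrow> ('a \<Rightarrow> 'a \<Rightarrow> real) \<Rightarrow> diagram" where
  "dgm _ F k X d =
     (THE D. has_diagram
        (homology_pm (sublevel_complex X (F X d)) k :: ('k, ('a list \<Rightarrow> 'k) set) persistence_module) D)"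

definition partial_matching ::
    "((real \<times> real) \<times> (real \<times> real)) multiset \<Rightarrow> diagram \<Rightarrow> diagram \<Rightarrow> bool" where
  "partial_matching M D E \<longleftrightarrow> image_mset fst M \<subseteq># D \<and> image_mset snd M \<subseteq># E"

definition matching_cost ::
    "((real \<times> real) \<times> (real \<times> real)) multiset \<Rightarrow> diagram \<Rightarrow> diagram \<Rightarrow> real" where
  "matching_cost M D E =
     Max ({0} \<union> {max \<bar>b - b'\<bar> \<bar>d - d'\<bar> | b d b' d'. ((b, d), (b', d')) \<in># M}
          \<union> {(d - b) / 2 | b d. (b, d) \<in># D - image_mset fst M}
          \<union> {(d - b) / 2 | b d. (b, d) \<in># E - image_mset snd M})"

definition bottleneck :: "diagram \<Rightarrow> diagram \<Rightarrow> real" where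
  "bottleneck D E = Inf {matching_cost M D E | M. partial_matching M D E}"

definition correspondence :: "'a set \<Rightarrow> 'b set \<Rightarrow> ('a \<times> 'b) set \<Rightarrow> bool" where
  "correspondence X Y R \<longleftrightarrow> R \<subseteq> X \<times> Y \<and> fst ` R = X \<and> snd ` R = Y"

definition distortion ::
    "('a \<Rightarrow> 'a \<Rightarrow> real) \<Rightarrow> ('b \<Rightarrow> 'b \<Rightarrow> real) \<Rightarrow> ('a \<times> 'b) set \<Rightarrow> ennreal" where
  "distortion dX dY R = (SUP (x, y)\<in>R. SUP (x', y')\<in>R. ennreal \<bar>dX x x' - dY y y'\<bar>)"

definition gromov_hausdorff ::
    "'a set \<Rightarrow> ('a \<Rightarrow> 'a \<Rightarrow> real) \<Rightarrow> 'b set \<Rightarrow> ('b \<Rightarrow> 'b \<Rightarrow> real) \<Rightarrow> ennreal" where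
  "gromov_hausdorff X dX Y dY = 1 / 2 * (INF R\<in>{R. correspondence X Y R}. distortion dX dY R)"

definition hausdorff :: "('b \<Rightarrow> 'b \<Rightarrow> real) \<Rightarrow> 'b set \<Rightarrow> 'b set \<Rightarrow> ennreal" where
  "hausdorff \<delta> A B =
     max (SUP a\<in>A. INF b\<in>B. ennreal (\<delta> a b)) (SUP b\<in>B. INF a\<in>A. ennreal (\<delta> a b))"

definition stability_constant :: "'k::field itself \<Rightarrow> 'a filtration \<Rightarrow> real \<Rightarrow> bool" where
  "stability_constant K F L \<longleftrightarrow>
     L > 0 \<and>
     (\<forall>X dX Y dY k. finite_metric_space X dX \<and> finite_metric_space Y dY \<longrightarrow>
        ennreal (bottleneck (dgm K F k X dX) (dgm K F k Y dY)) \<le> ennreal L * gromov_hausdorff X dX Y dY)"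

definition stable_filtration_functor :: "'k::field itself \<Rightarrow> 'a filtration \<Rightarrow> bool" where
  "stable_filtration_functor K F \<longleftrightarrow> filtration_functor F \<and> (\<exists>L. stability_constant K F L)"

definition lipschitz_constant :: "'k::field itself \<Rightarrow> 'a filtration \<Rightarrow> real" where
  "lipschitz_constant K F = Inf {L. stability_constant K F L}"

definition persistence_set ::
    "'k::field itself \<Rightarrow> 'a filtration \<Rightarrow> nat \<Rightarrow> nat \<Rightarrow> 'a set \<Rightarrow> ('a \<Rightarrow> 'a \<Rightarrow> real) \<Rightarrow> diagram set" where
  "persistence_set K F n k X d =
     {dgm K F k X' d | X'. X' \<subseteq> X \<and> X' \<noteq> {} \<and> finite X' \<and> card X' \<le> n}"

definition curvature_set :: "nat \<Rightarrow> 'a set \<Rightarrow> ('a \<Rightarrow> 'a \<Rightarrow> real) \<Rightarrow> real mat set" where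
  "curvature_set n X d = {mat n n (\<lambda>(i, j). d (x i) (x j)) | x. \<forall>i<n. x i \<in> X}"

definition mat_dist :: "real mat \<Rightarrow> real mat \<Rightarrow> real" where
  "mat_dist A B = Max {\<bar>A $$ (i, j) - B $$ (i, j)\<bar> | i j. i < dim_row A \<and> j < dim_col A}"

definition modified_gromov_hausdorff ::
    "'a set \<Rightarrow> ('a \<Rightarrow> 'a \<Rightarrow> real) \<Rightarrow> 'b set \<Rightarrow> ('b \<Rightarrow> 'b \<Rightarrow> real) \<Rightarrow> ennreal" where
  "modified_gromov_hausdorff X dX Y dY =
     1 / 2 * (SUP n\<in>{1..}. hausdorff mat_dist (curvature_set n X dX) (curvature_set n Y dY))"

end

theory Submission
  imports Defs
begin

text \<open>
  A nonempty subset with at most \<open>n\<close> points is the set of entries of an \<open>n\<close>-tuple, whose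
  distance matrix lies in the \<open>n\<close>-th curvature set. The tuples of two distance matrices \<open>A\<close> and
  \<open>B\<close> give the correspondence \<open>{(x i, y i) | i < n}\<close>, whose distortion is at most the
  \<open>\<ell>\<^sup>\<infinity>\<close> distance of \<open>A\<close> and \<open>B\<close>. Stability turns half of this distortion into a bound
  on the bottleneck distance of the diagrams. No optimal matrices have to exist, as the estimate
  holds for all pairs and passes to infima.
\<close>

section \<open>Infima and Hausdorff distances with values in [0, \<infinity>]\<close>

lemma INF_cmult_ennreal:
  fixes c :: ennreal and f :: "'b \<Rightarrow> ennreal"
  assumes "c \<noteq> \<infinity>" "I \<noteq> {}"
  shows "(INF i\<in>I. c * f i) = c * (INF i\<in>I. f i)"
proof -
  \<comment> \<open>Infima are approached from the right, so right continuity and monotonicity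
    suffice. For \<open>c = \<infinity>\<close> continuity fails at 0.\<close>
  have "continuous (at_right z) (\<lambda>x. c * x)" for z
    using assms(1) by (simp add: continuous_within ennreal_tendsto_cmult less_top)
  then have "c * (INF i\<in>I. f i) = (INF x\<in>f ` I. c * x)"
    using assms(2) by (intro continuous_at_Inf_mono) (auto simp: mono_def mult_left_mono)
  then show ?thesis
    by (simp add: image_image)
qed

text \<open>The point \<open>a\<close> depends on \<open>p\<close> alone, while \<open>b\<close>
  stays arbitrary. Hence the estimate can be taken to the infimum over \<open>b\<close>, and no
  nearest point of \<open>B\<close> has to be chosen.\<close>

lemma hausdorff_le_mult:
  fixes c :: real
  assumes "c \<ge> 0" "A \<noteq> {}" "B \<noteq> {}"
    and left: "\<And>p. p \<in> P \<Longrightarrow> \<exists>a\<in>A. \<forall>b\<in>B. \<exists>q\<in>Q. \<delta> p q \<le> c * \<epsilon> a b"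
    and right: "\<And>q. q \<in> Q \<Longrightarrow> \<exists>b\<in>B. \<forall>a\<in>A. \<exists>p\<in>P. \<delta> p q \<le> c * \<epsilon> a b"
  shows "hausdorff \<delta> P Q \<le> ennreal c * hausdorff \<epsilon> A B"
proof -
  have "(INF q\<in>Q. ennreal (\<delta> p q)) \<le> ennreal c * hausdorff \<epsilon> A B" if "p \<in> P" for p
  proof -
    obtain a where a: "a \<in> A" "\<forall>b\<in>B. \<exists>q\<in>Q. \<delta> p q \<le> c * \<epsilon> a b"
      using left \<open>p \<in> P\<close> by blast
    have "(INF q\<in>Q. ennreal (\<delta> p q)) \<le> (INF b\<in>B. ennreal c * ennreal (\<epsilon> a b))"
      using a(2) \<open>c \<ge> 0\<close>
      by (fastforce intro: INF_greatest INF_lower2 ennreal_leI simp flip: ennreal_mult')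
    also have "\<dots> = ennreal c * (INF b\<in>B. ennreal (\<epsilon> a b))"
      using \<open>B \<noteq> {}\<close> by (intro INF_cmult_ennreal) simp_all
    also have "(INF b\<in>B. ennreal (\<epsilon> a b)) \<le> hausdorff \<epsilon> A B"
      unfolding hausdorff_def using a(1) by (intro max.coboundedI1 SUP_upper)
    finally show ?thesis
      by (simp add: mult_left_mono)
  qed
  moreover have "(INF p\<in>P. ennreal (\<delta> p q)) \<le> ennreal c * hausdorff \<epsilon> A B" if "q \<in> Q" for q
  proof -
    obtain b where b: "b \<in> B" "\<forall>a\<in>A. \<exists>p\<in>P. \<delta> p q \<le> c * \<epsilon> a b"
      using right \<open>q \<in> Q\<close> by blast
    have "(INF p\<in>P. ennreal (\<delta> p q)) \<le> (INF a\<in>A. ennreal c * ennreal (\<epsilon> a b))"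
      using b(2) \<open>c \<ge> 0\<close>
      by (fastforce intro: INF_greatest INF_lower2 ennreal_leI simp flip: ennreal_mult')
    also have "\<dots> = ennreal c * (INF a\<in>A. ennreal (\<epsilon> a b))"
      using \<open>A \<noteq> {}\<close> by (intro INF_cmult_ennreal) simp_all
    also have "(INF a\<in>A. ennreal (\<epsilon> a b)) \<le> hausdorff \<epsilon> A B"
      unfolding hausdorff_def using b(1) by (intro max.coboundedI2 SUP_upper)
    finally show ?thesis
      by (simp add: mult_left_mono)
  qed
  ultimately show ?thesis
    by (subst hausdorff_def) (intro max.boundedI SUP_least; blast)
qed

section \<open>Distance matrices and the Gromov-Hausdorff distance\<close>

lemma abs_diff_le_mat_dist:
  assumes "i < dim_row A" "j < dim_col A"
  shows "\<bar>A $$ (i, j) - B $$ (i, j)\<bar> \<le> mat_dist A B"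
proof -
  \<comment> \<open>As an image of a finite product the set is visibly finite, so that
    \<open>Max\<close> bounds its elements.\<close>
  have "{\<bar>A $$ (i, j) - B $$ (i, j)\<bar> | i j. i < dim_row A \<and> j < dim_col A}
      = (\<lambda>(i, j). \<bar>A $$ (i, j) - B $$ (i, j)\<bar>) ` ({..<dim_row A} \<times> {..<dim_col A})"
    by force
  then show ?thesis
    unfolding mat_dist_def using assms by (intro Max_ge) auto
qed

text \<open>Matching equal indices is allowed even if the two tuples repeat points at different
  places, because a correspondence need not be the graph of a map.\<close>

lemma gromov_hausdorff_le_mat_dist:
  assumes "n \<ge> 1"
  shows "gromov_hausdorff (x ` {..<n}) dX (y ` {..<n}) dY
    \<le> ennreal (mat_dist (mat n n (\<lambda>(i, j). dX (x i) (x j))) (mat n n (\<lambda>(i, j). dY (y i) (y j))) / 2)"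
    (is "_ \<le> ennreal (?m / 2)")
proof -
  let ?R = "(\<lambda>i. (x i, y i)) ` {..<n}"
  have entry: "\<bar>dX (x i) (x j) - dY (y i) (y j)\<bar> \<le> ?m" if "i < n" "j < n" for i j
    using abs_diff_le_mat_dist[of i "mat n n (\<lambda>(i, j). dX (x i) (x j))" j
        "mat n n (\<lambda>(i, j). dY (y i) (y j))"] that by simp
  have "correspondence (x ` {..<n}) (y ` {..<n}) ?R"
    by (auto simp: correspondence_def image_image)
  then have "(INF R\<in>{R. correspondence (x ` {..<n}) (y ` {..<n}) R}. distortion dX dY R)
      \<le> distortion dX dY ?R"
    by (intro INF_lower) simp
  also have "\<dots> \<le> ennreal ?m"
    unfolding distortion_def by (intro SUP_least) (auto intro!: SUP_least ennreal_leI entry)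
  finally have "gromov_hausdorff (x ` {..<n}) dX (y ` {..<n}) dY \<le> 1 / 2 * ennreal ?m"
    unfolding gromov_hausdorff_def by (intro mult_left_mono) simp_all
  also have "\<dots> = ennreal (?m / 2)"
  proof -
    \<comment> \<open>The entry at (0, 0) exists because \<open>n \<ge> 1\<close>; it bounds
      \<open>?m\<close> below by an absolute value.\<close>
    have "0 \<le> ?m"
      using entry[of 0 0] assms by linarith
    then show ?thesis
      using divide_ennreal[of ?m 2] by (subst mult.commute) (simp add: ennreal_times_divide)
  qed
  finally show ?thesis .
qed

section \<open>The Lipschitz constant as an infimum\<close>

lemma lipschitz_constant_nonneg:
  assumes "stable_filtration_functor K F"
  shows "0 \<le> lipschitz_constant K F"
  unfolding lipschitz_constant_def
proof (rule cInf_greatest)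
  show "{L. stability_constant K F L} \<noteq> {}"
    using assms by (auto simp: stable_filtration_functor_def)
qed (auto simp: stability_constant_def)

text \<open>The infimum need not be a stability constant itself; for instance, it may be 0. The
  bound is therefore proved for each stability constant and then passed to the infimum.\<close>

lemma bottleneck_dgm_le_lipschitz_constant:
  assumes "stable_filtration_functor K F"
    and "finite_metric_space X dX" "finite_metric_space Y dY"
    and m: "gromov_hausdorff X dX Y dY \<le> ennreal m" "m \<ge> 0"
  shows "bottleneck (dgm K F k X dX) (dgm K F k Y dY) \<le> lipschitz_constant K F * m"
    (is "?b \<le> _")
proof -
  have bound: "?b \<le> L * m" if L: "stability_constant K F L" for L
  proof -
    have "ennreal ?b \<le> ennreal L * gromov_hausdorff X dX Y dY"
      using L assms(2,3) by (auto simp: stability_constant_def)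
    also have "\<dots> \<le> ennreal L * ennreal m"
      by (intro mult_left_mono m) simp
    also have "\<dots> = ennreal (L * m)"
      using \<open>m \<ge> 0\<close> by (simp add: ennreal_mult'')
    finally show ?thesis
      using L \<open>m \<ge> 0\<close> by (simp add: ennreal_le_iff stability_constant_def)
  qed
  obtain L where L: "stability_constant K F L"
    using assms(1) by (auto simp: stable_filtration_functor_def)
  show ?thesis
  \<comment> \<open>Dividing by \<open>m\<close> turns the bounds into a lower bound of all
    stability constants. For \<open>m = 0\<close>, a single constant already gives the bound
    0.\<close>
  proof (cases "m = 0")
    case True
    then show ?thesis
      using bound[OF L] by simp
  next
    case False
    then have "?b / m \<le> lipschitz_constant K F"
      unfolding lipschitz_constant_def using L bound \<open>m \<ge> 0\<close>
      by (intro cInf_greatest) (auto simp: divide_simps)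
    then show ?thesis
      using False \<open>m \<ge> 0\<close> by (simp add: divide_simps)
  qed
qed

section \<open>Subsets as entries of tuples\<close>

lemma finite_metric_space_tuple:
  fixes n :: nat
  assumes "Metric_space X d" "n \<ge> 1" "\<forall>i<n. x i \<in> X"
  shows "finite_metric_space (x ` {..<n}) d"
  using assms Metric_space.subspace[of X d "x ` {..<n}"]
  by (auto simp: finite_metric_space_def lessThan_empty_iff)

lemma obtain_tuple:
  assumes "S \<noteq> {}" "finite S" "card S \<le> n"
  obtains x where "x ` {..<n} = S"
proof -
  obtain h where h: "bij_betw h {..<card S} S"
    using ex_bij_betw_nat_finite[OF \<open>finite S\<close>] by (auto simp: atLeast0LessThan)
  obtain s where "s \<in> S"
    using \<open>S \<noteq> {}\<close> by blast
  \<comment> \<open>An enumeration of \<open>S\<close> is padded to length \<open>n\<close> by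
    repeating the point \<open>s\<close>.\<close>
  have "(\<lambda>i. if i < card S then h i else s) ` {..<n} = S" (is "?g ` _ = S")
  proof
    show "?g ` {..<n} \<subseteq> S"
      using h \<open>s \<in> S\<close> by (auto simp: bij_betw_def)
    show "S \<subseteq> ?g ` {..<n}"
    proof
      fix t
      assume "t \<in> S"
      then obtain i where "i < card S" "t = h i"
        using h by (auto simp: bij_betw_def)
      then show "t \<in> ?g ` {..<n}"
        using \<open>card S \<le> n\<close> by (intro image_eqI[of _ _ i]) auto
    qed
  qed
  then show thesis
    using that by blast
qed

text \<open>Repetitions absorb the difference between at most \<open>n\<close> points and exactly
  \<open>n\<close> entries, so both kinds of sets are indexed by the same tuples.\<close>

lemma persistence_set_eq_tuples:
  assumes "n \<ge> 1"
  shows "persistence_set K F n k X d = {dgm K F k (x ` {..<n}) d | x. \<forall>i<n. x i \<in> X}"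
proof (intro equalityI subsetI)
  fix D
  assume "D \<in> persistence_set K F n k X d"
  then obtain S where S: "D = dgm K F k S d" "S \<subseteq> X" "S \<noteq> {}" "finite S" "card S \<le> n"
    by (auto simp: persistence_set_def)
  then obtain x where "x ` {..<n} = S"
    using obtain_tuple by metis
  then show "D \<in> {dgm K F k (x ` {..<n}) d | x. \<forall>i<n. x i \<in> X}"
    using S by blast
next
  fix D
  assume "D \<in> {dgm K F k (x ` {..<n}) d | x. \<forall>i<n. x i \<in> X}"
  then obtain x where x: "D = dgm K F k (x ` {..<n}) d" "\<forall>i<n. x i \<in> X"
    by blast
  moreover have "card (x ` {..<n}) \<le> n"
    using card_image_le[of "{..<n}" x] by simp
  ultimately show "D \<in> persistence_set K F n k X d"
    using assms unfolding persistence_set_def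
    by (intro CollectI exI[of _ "x ` {..<n}"]) (auto simp: lessThan_empty_iff)
qed

lemma curvature_set_nonempty:
  assumes "X \<noteq> {}"
  shows "curvature_set n X d \<noteq> {}"
proof -
  obtain z where "z \<in> X"
    using assms by blast
  then have "mat n n (\<lambda>(i, j). d z z) \<in> curvature_set n X d"
    unfolding curvature_set_def by (intro CollectI exI[of _ "\<lambda>_. z"]) simp
  then show ?thesis
    by blast
qed

section \<open>Comparison of persistence sets with curvature sets\<close>

theorem theorem3p13:
  fixes F :: "'a filtration"
    and X Y :: "'a set"
    and dX dY :: "'a \<Rightarrow> 'a \<Rightarrow> real"
    and n k :: nat
  assumes "stable_filtration_functor TYPE('k::field) F"
    and "compact_metric_space X dX"
    and "compact_metric_space Y dY"
    and "n \<ge> 1"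
  shows "hausdorff bottleneck
           (persistence_set TYPE('k) F n k X dX) (persistence_set TYPE('k) F n k Y dY)
         \<le> ennreal (1 / 2 * lipschitz_constant TYPE('k) F) *
           hausdorff mat_dist (curvature_set n X dX) (curvature_set n Y dY)
       \<and> hausdorff bottleneck
           (persistence_set TYPE('k) F n k X dX) (persistence_set TYPE('k) F n k Y dY)
         \<le> ennreal (lipschitz_constant TYPE('k) F) * modified_gromov_hausdorff X dX Y dY"
proof -
  let ?L = "lipschitz_constant TYPE('k) F"
  let ?P = "hausdorff bottleneck
    (persistence_set TYPE('k) F n k X dX) (persistence_set TYPE('k) F n k Y dY)"
  let ?K = "\<lambda>n. hausdorff mat_dist (curvature_set n X dX) (curvature_set n Y dY)"
  define A where "A x = mat n n (\<lambda>(i, j). dX (x i) (x j))" for x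
  define B where "B y = mat n n (\<lambda>(i, j). dY (y i) (y j))" for y
  have X: "Metric_space X dX" "X \<noteq> {}" and Y: "Metric_space Y dY" "Y \<noteq> {}"
    using assms by (auto simp: compact_metric_space_def)
  have L: "0 \<le> ?L"
    by (rule lipschitz_constant_nonneg) (rule assms(1))
  \<comment> \<open>The factor 1/2 is the one in the definition of the Gromov-Hausdorff distance.
    The two tuples are independent of each other.\<close>
  have tuples: "bottleneck (dgm TYPE('k) F k (x ` {..<n}) dX) (dgm TYPE('k) F k (y ` {..<n}) dY)
      \<le> 1 / 2 * ?L * mat_dist (A x) (B y)"
    if "\<forall>i<n. x i \<in> X" "\<forall>i<n. y i \<in> Y" for x y
  proof -
    have "0 \<le> mat_dist (A x) (B y)"
      using abs_diff_le_mat_dist[of 0 "A x" 0 "B y"] assms(4) by (simp add: A_def)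
    then have "bottleneck (dgm TYPE('k) F k (x ` {..<n}) dX) (dgm TYPE('k) F k (y ` {..<n}) dY)
        \<le> ?L * (mat_dist (A x) (B y) / 2)"
      using gromov_hausdorff_le_mat_dist[OF assms(4), of x dX y dY] assms(4) that
      by (intro bottleneck_dgm_le_lipschitz_constant[OF assms(1)]
          finite_metric_space_tuple[OF X(1)] finite_metric_space_tuple[OF Y(1)])
        (simp_all add: A_def B_def)
    then show ?thesis
      by simp
  qed
  have "?P \<le> ennreal (1 / 2 * ?L) * ?K n"
  proof (rule hausdorff_le_mult)
    show "curvature_set n X dX \<noteq> {}" "curvature_set n Y dY \<noteq> {}"
      using X Y by (simp_all add: curvature_set_nonempty)
  next
    fix p
    assume "p \<in> persistence_set TYPE('k) F n k X dX"
    then obtain x where x: "\<forall>i<n. x i \<in> X" "p = dgm TYPE('k) F k (x ` {..<n}) dX"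
      by (auto simp: persistence_set_eq_tuples[OF assms(4)])
    show "\<exists>a\<in>curvature_set n X dX. \<forall>b\<in>curvature_set n Y dY.
        \<exists>q\<in>persistence_set TYPE('k) F n k Y dY. bottleneck p q \<le> 1 / 2 * ?L * mat_dist a b"
    proof (intro bexI[of _ "A x"] ballI)
      fix b
      assume "b \<in> curvature_set n Y dY"
      then obtain y where y: "\<forall>i<n. y i \<in> Y" "b = B y"
        by (auto simp: curvature_set_def B_def)
      have "bottleneck p (dgm TYPE('k) F k (y ` {..<n}) dY) \<le> 1 / 2 * ?L * mat_dist (A x) b"
        unfolding x(2) y(2) by (rule tuples[OF x(1) y(1)])
      moreover have "dgm TYPE('k) F k (y ` {..<n}) dY \<in> persistence_set TYPE('k) F n k Y dY"
        using y(1) by (auto simp: persistence_set_eq_tuples[OF assms(4)])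
      ultimately show "\<exists>q\<in>persistence_set TYPE('k) F n k Y dY.
          bottleneck p q \<le> 1 / 2 * ?L * mat_dist (A x) b" ..
    qed (use x(1) in \<open>auto simp: curvature_set_def A_def\<close>)
  next
    \<comment> \<open>The roles of the spaces are exchanged, but the arguments of both distances
      keep their order, so no symmetry is invoked.\<close>
    fix q
    assume "q \<in> persistence_set TYPE('k) F n k Y dY"
    then obtain y where y: "\<forall>i<n. y i \<in> Y" "q = dgm TYPE('k) F k (y ` {..<n}) dY"
      by (auto simp: persistence_set_eq_tuples[OF assms(4)])
    show "\<exists>b\<in>curvature_set n Y dY. \<forall>a\<in>curvature_set n X dX.
        \<exists>p\<in>persistence_set TYPE('k) F n k X dX. bottleneck p q \<le> 1 / 2 * ?L * mat_dist a b"
    proof (intro bexI[of _ "B y"] ballI)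
      fix a
      assume "a \<in> curvature_set n X dX"
      then obtain x where x: "\<forall>i<n. x i \<in> X" "a = A x"
        by (auto simp: curvature_set_def A_def)
      have "bottleneck (dgm TYPE('k) F k (x ` {..<n}) dX) q \<le> 1 / 2 * ?L * mat_dist a (B y)"
        unfolding x(2) y(2) by (rule tuples[OF x(1) y(1)])
      moreover have "dgm TYPE('k) F k (x ` {..<n}) dX \<in> persistence_set TYPE('k) F n k X dX"
        using x(1) by (auto simp: persistence_set_eq_tuples[OF assms(4)])
      ultimately show "\<exists>p\<in>persistence_set TYPE('k) F n k X dX.
          bottleneck p q \<le> 1 / 2 * ?L * mat_dist a (B y)" ..
    qed (use y(1) in \<open>auto simp: curvature_set_def B_def\<close>)
  qed (use L in simp)
  \<comment> \<open>The factor 1/2 moves into the modified distance, whose supremum dominates its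
    \<open>n\<close>-th term.\<close>
  moreover have "ennreal (1 / 2 * ?L) * ?K n \<le> ennreal ?L * modified_gromov_hausdorff X dX Y dY"
  proof -
    have "ennreal (1 / 2 * ?L) = ennreal ?L * (1 / 2)"
      using L divide_ennreal[of ?L 2] by (simp add: ennreal_times_divide)
    moreover have "?K n \<le> (SUP n\<in>{1..}. ?K n)"
      using assms(4) by (intro SUP_upper) simp
    ultimately show ?thesis
      unfolding modified_gromov_hausdorff_def by (simp add: mult.assoc mult_left_mono)
  qed
  ultimately show ?thesis
    by (blast intro: order_trans)
qed

end
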